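(* Let $n$ be a positive integer and let $R$ be a local ring such that each proper principal ideal of $R$ has an $n$-OA-factorization. Then each nonmaximal minimal prime ideal of $R$ is principal.
   Context: All rings are commutative with $1\neq 0$. A local ring is a ring with a unique maximal ideal (not assumed Noetherian). A proper ideal $I$ of a ring $R$ is an $n$-OA ideal if whenever $a_1a_2\cdots a_{n+1}\in I$ for nonunits $a_1,\ldots,a_{n+1}\in R$, then $a_1a_2\cdots a_n\in I$ or $a_{n+1}\in I$. An $n$-OA-factorization of an ideal $I$ is an expression $I=\prod_{i=1}^m I_i$ of $I$ as a product of finitely many $n$-OA ideals of $R$. *)

theory Defs
  imports "HOL-Algebra.Ideal_Product"
begin

text \<open>
  The standing convention \<open>1 \<noteq> 0\<close> is implied here: a maximal ideal is proper, whereas the zero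
  ring has no proper ideal.
\<close>

locale local_ring = cring +
  assumes unique_maximalideal: "\<exists>!M. maximalideal M R"

definition minimal_primeideal :: "'a set \<Rightarrow> ('a, 'b) ring_scheme \<Rightarrow> bool" where
  "minimal_primeideal P R \<longleftrightarrow>
     primeideal P R \<and> (\<forall>Q. primeideal Q R \<longrightarrow> Q \<subseteq> P \<longrightarrow> Q = P)"

definition OA_ideal :: "nat \<Rightarrow> 'a set \<Rightarrow> ('a, 'b) ring_scheme \<Rightarrow> bool" where
  "OA_ideal n I R \<longleftrightarrow>
     ideal I R \<and> I \<noteq> carrier R \<and>
     (\<forall>a \<in> {1..n + 1} \<rightarrow> carrier R - Units R.
        (\<Otimes>\<^bsub>R\<^esub> i \<in> {1..n + 1}. a i) \<in> I \<longrightarrow>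
        (\<Otimes>\<^bsub>R\<^esub> i \<in> {1..n}. a i) \<in> I \<or> a (n + 1) \<in> I)"

text \<open>
  The product is taken in the commutative monoid of ideals, so that for \<open>m = 0\<close> it is the unit
  ideal; a proper ideal can only be factored with \<open>m \<ge> 1\<close>.
\<close>

definition has_OA_factorization :: "nat \<Rightarrow> 'a set \<Rightarrow> ('a, 'b) ring_scheme \<Rightarrow> bool" where
  "has_OA_factorization n I R \<longleftrightarrow>
     (\<exists>(m :: nat) J. (\<forall>i \<in> {1..m}. OA_ideal n (J i) R) \<and>
        I = (\<Otimes>\<^bsub>ideals_set R\<^esub> i \<in> {1..m}. J i))"

end

theory Submission
  imports Defs "HOL-Algebra.Ring_Divisibility"
begin

text \<open>
  Let \<open>M\<close> be the maximal ideal and \<open>P\<close> a nonmaximal minimal prime.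

  An \<open>n\<close>-OA ideal that is not prime contains \<open>M\<^sup>n\<close>, so the only prime ideal that can lie above it is
  \<open>M\<close>. Hence an \<open>n\<close>-OA ideal contained in \<open>P\<close> is prime, and then equals \<open>P\<close> by minimality
  (\<open>OA_ideal_below_prime\<close>). For \<open>x \<in> P\<close>, some factor of an \<open>n\<close>-OA-factorization of the principal
  ideal \<open>(x)\<close> lies in the prime \<open>P\<close>, so this factor is \<open>P\<close> itself and \<open>(x) = P A\<^sub>x\<close> for some ideal
  \<open>A\<^sub>x\<close>. In other words, \<open>P\<close> is a multiplication ideal: it divides every ideal inside it.

  A multiplication ideal \<open>P\<close> of a local ring is principal (\<open>principalideal_if_divides_principals\<close>).
  If some \<open>A\<^sub>x\<close> is the whole ring, then \<open>P = (x)\<close>. Otherwise every \<open>A\<^sub>x\<close> lies in \<open>M\<close>, which gives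
  \<open>P = P M\<close>; multiplying by \<open>A\<^sub>x\<close> turns this into \<open>(x) = M (x)\<close>, so that \<open>x = 0\<close> by Nakayama's
  lemma, for every \<open>x \<in> P\<close>. Thus \<open>P = 0\<close>.
\<close>

section \<open>Local rings\<close>

lemma (in ring) proper_ideal_in_maximalideal:
  assumes "ideal I R" "I \<noteq> carrier R"
  shows "\<exists>M. maximalideal M R \<and> I \<subseteq> M"
proof -
  define A where "A = {J. ideal J R \<and> I \<subseteq> J \<and> \<one> \<notin> J}"
  have proper: "J = carrier R \<longleftrightarrow> \<one> \<in> J" if "ideal J R" for J
    using ideal.one_imp_carrier[OF that] by auto
  have "A \<noteq> {}"
    using assms proper unfolding A_def by blast
  moreover have "\<Union>C \<in> A" if ne: "C \<noteq> {}" and C: "subset.chain A C" for C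
  proof -
    have "subset.chain {J. ideal J R} C"
      using C unfolding subset_chain_def A_def by auto
    hence "ideal (\<Union>C) R"
      using chain_Union_is_ideal[of C] ne by simp
    moreover have "C \<subseteq> A"
      using C unfolding subset_chain_def by blast
    ultimately show ?thesis
      using ne unfolding A_def by blast
  qed
  ultimately obtain M where M: "M \<in> A" "\<And>J. J \<in> A \<Longrightarrow> M \<subseteq> J \<Longrightarrow> J = M"
    using subset_Zorn_nonempty[of A] by blast
  have "maximalideal M R"
  proof (rule maximalidealI)
    show "ideal M R" "carrier R \<noteq> M"
      using M(1) unfolding A_def by auto
    show "J = M \<or> J = carrier R" if "ideal J R" "M \<subseteq> J" for J
      using M that proper unfolding A_def by blast
  qed
  thus ?thesis
    using M(1) unfolding A_def by blast
qed

lemma (in local_ring) proper_ideal_subset_maximalideal: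
  assumes "maximalideal M R" "ideal I R" "I \<noteq> carrier R"
  shows "I \<subseteq> M"
  using proper_ideal_in_maximalideal[OF assms(2,3)] unique_maximalideal assms(1) by blast

lemma (in local_ring) one_minus_maximal_unit:
  assumes M: "maximalideal M R" and m: "m \<in> M"
  shows "\<one> \<ominus> m \<in> Units R"
proof -
  interpret M: maximalideal M R by fact
  have mc: "m \<in> carrier R" using m by (rule M.Icarr)
  have "PIdl (\<one> \<ominus> m) = carrier R"
  proof (rule ccontr)
    assume "PIdl (\<one> \<ominus> m) \<noteq> carrier R"
    hence "PIdl (\<one> \<ominus> m) \<subseteq> M"
      using proper_ideal_subset_maximalideal[OF M] mc by (simp add: cgenideal_ideal)
    hence "\<one> \<ominus> m \<in> M"
      using cgenideal_self mc by blast
    hence "(\<one> \<ominus> m) \<oplus> m \<in> M"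
      using m by (rule M.a_closed)
    moreover have "(\<one> \<ominus> m) \<oplus> m = \<one>"
      using mc by algebra
    ultimately show False
      using M.one_imp_carrier M.I_notcarr by auto
  qed
  hence "\<one> \<in> PIdl (\<one> \<ominus> m)" by simp
  then obtain y where "y \<in> carrier R" "\<one> = y \<otimes> (\<one> \<ominus> m)"
    unfolding cgenideal_def by blast
  thus ?thesis
    using mc m_comm[of y "\<one> \<ominus> m"] unfolding Units_def by auto
qed

lemma (in cring) ideal_prod_cgenideal:
  assumes I: "ideal I R" and x: "x \<in> carrier R" and s: "s \<in> I \<cdot> (PIdl x)"
  shows "\<exists>m \<in> I. s = m \<otimes> x"
  using s
proof (induct s rule: ideal_prod.induct)
  case (prod i j)
  then obtain r where r: "r \<in> carrier R" "j = r \<otimes> x"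
    unfolding cgenideal_def by blast
  have "i \<otimes> j = (i \<otimes> r) \<otimes> x"
    using r x ideal.Icarr[OF I prod(1)] by (simp add: m_assoc)
  thus ?case
    using ideal.I_r_closed[OF I prod(1) r(1)] by blast
next
  case (sum s t)
  then obtain a b where ab: "a \<in> I" "b \<in> I" "s = a \<otimes> x" "t = b \<otimes> x"
    by blast
  hence "s \<oplus> t = (a \<oplus> b) \<otimes> x"
    using x ideal.Icarr[OF I] by (simp add: l_distr)
  thus ?case
    using additive_subgroup.a_closed[OF ideal.axioms(1)[OF I]] ab by blast
qed

text \<open>Nakayama's lemma for a principal ideal: \<open>x = m x\<close> with \<open>m \<in> M\<close>, and \<open>1 - m\<close> is a unit.\<close>

lemma (in local_ring) eq_zero_if_in_maximalideal_prod:
  assumes M: "maximalideal M R" and x: "x \<in> carrier R" "x \<in> M \<cdot> (PIdl x)"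
  shows "x = \<zero>"
proof -
  have I: "ideal M R" using M by (rule maximalideal.axioms(1))
  obtain m where m: "m \<in> M" "x = m \<otimes> x"
    using ideal_prod_cgenideal[OF I x] by blast
  have mc: "m \<in> carrier R" using ideal.Icarr[OF I m(1)] .
  have "(\<one> \<ominus> m) \<otimes> x = x \<ominus> m \<otimes> x"
    using mc x(1) by algebra
  also have "\<dots> = \<zero>"
    using m(2) x(1) r_right_minus_eq by metis
  finally have "(\<one> \<ominus> m) \<otimes> x = (\<one> \<ominus> m) \<otimes> \<zero>"
    using mc by simp
  thus ?thesis
    using Units_l_cancel[OF one_minus_maximal_unit[OF M m(1)] x(1) zero_closed] by simp
qed

text \<open>
  If \<open>I\<close> is not one of the principal ideals inside it, then all the cofactors are proper, and
  \<open>I = I M\<close> forces \<open>I = 0\<close>: Nakayama's lemma is applied not to \<open>I\<close>, which need not be finitely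
  generated, but to the principal ideals \<open>(x) = I A = M I A = M (x)\<close>.
\<close>

lemma (in local_ring) principalideal_if_divides_principals:
  assumes I: "ideal I R"
    and div: "\<And>x. x \<in> I \<Longrightarrow> \<exists>A. ideal A R \<and> PIdl x = I \<cdot> A"
  shows "principalideal I R"
proof (cases "\<exists>x \<in> I. PIdl x = I")
  case True
  then obtain x where "x \<in> I" "PIdl x = I" by blast
  thus ?thesis
    using cgenideal_is_principalideal[of x] ideal.Icarr[OF I] by simp
next
  case False
  obtain M where M: "maximalideal M R"
    using unique_maximalideal by blast
  have MI: "ideal M R" using M by (rule maximalideal.axioms(1))
  have mono: "I \<cdot> A \<subseteq> I \<cdot> M" if "A \<subseteq> M" for A
  proof
    fix s assume "s \<in> I \<cdot> A"
    thus "s \<in> I \<cdot> M"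
      using that by (induct s rule: ideal_prod.induct) (auto intro: ideal_prod.intros)
  qed
  have "I \<subseteq> I \<cdot> M"
  proof
    fix x assume x: "x \<in> I"
    obtain A where A: "ideal A R" "PIdl x = I \<cdot> A"
      using div[OF x] by blast
    have "A \<noteq> carrier R"
      using False x A(2) ideal_prod_one[OF I] by auto
    hence "A \<subseteq> M"
      using proper_ideal_subset_maximalideal[OF M A(1)] by simp
    moreover have "x \<in> I \<cdot> A"
      using cgenideal_self[OF ideal.Icarr[OF I x]] A(2) by simp
    ultimately show "x \<in> I \<cdot> M"
      using mono by blast
  qed
  hence IM: "I = M \<cdot> I"
    using ideal_prod_inter[OF I MI] ideal_prod_commute[OF I MI] by blast
  have "x = \<zero>" if x: "x \<in> I" for x
  proof -
    obtain A where A: "ideal A R" "PIdl x = I \<cdot> A"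
      using div[OF x] by blast
    have "PIdl x = M \<cdot> (PIdl x)"
      using ideal_prod_assoc[OF MI I A(1)] IM A(2) by simp
    moreover have xc: "x \<in> carrier R"
      using ideal.Icarr[OF I x] .
    ultimately show ?thesis
      using eq_zero_if_in_maximalideal_prod[OF M xc] cgenideal_self[OF xc] by simp
  qed
  hence "I = {\<zero>}"
    using additive_subgroup.zero_closed[OF ideal.axioms(1)[OF I]] by blast
  thus ?thesis
    using I genideal_zero by (intro principalidealI) auto
qed

section \<open>OA ideals below a prime\<close>

lemma (in cring) nonunit_outside_nonmaximal:
  assumes P: "ideal P R" "P \<noteq> carrier R" "\<not> maximalideal P R"
  shows "\<exists>z \<in> carrier R - Units R. z \<notin> P"
proof (rule ccontr)
  assume *: "\<not> (\<exists>z \<in> carrier R - Units R. z \<notin> P)"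
  have "maximalideal P R"
  proof (rule maximalidealI)
    show "ideal P R" "carrier R \<noteq> P" using P by auto
    fix J assume J: "ideal J R" "P \<subseteq> J" "J \<subseteq> carrier R"
    show "J = P \<or> J = carrier R"
    proof (cases "J = P")
      case False
      then obtain u where u: "u \<in> J" "u \<in> Units R"
        using J * by blast
      hence "inv u \<otimes> u \<in> J"
        using ideal.I_l_closed[OF J(1)] by blast
      thus ?thesis
        using u ideal.one_imp_carrier[OF J(1)] by simp
    qed simp
  qed
  thus False using P(3) by simp
qed

text \<open>
  To show that an OA ideal below a nonmaximal prime is prime, it is enough to test the OA condition
  on sequences \<open>z, \<dots>, z, a, b\<close>, where \<open>z\<close> is a nonunit outside the larger prime.
\<close>

lemma (in cring) OA_ideal_pow_cases:
  assumes "OA_ideal (Suc k) I R"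
    and z: "z \<in> carrier R - Units R" and a: "a \<in> carrier R - Units R" and b: "b \<in> carrier R - Units R"
    and mem: "z [^] k \<otimes> a \<otimes> b \<in> I"
  shows "z [^] k \<otimes> a \<in> I \<or> b \<in> I"
proof -
  define c where "c = (\<lambda>i. if i = Suc (Suc k) then b else if i = Suc k then a else z)"
  have c: "c i \<in> carrier R - Units R" for i
    using z a b unfolding c_def by simp
  hence cc: "c \<in> S \<rightarrow> carrier R" for S
    by auto
  have "(\<Otimes>i \<in> {1..k}. c i) = (\<Otimes>i \<in> {1..k}. z)"
    using z by (intro finprod_cong') (auto simp: c_def)
  also have "\<dots> = z [^] k"
    using z by (simp add: finprod_const)
  finally have 0: "(\<Otimes>i \<in> {1..k}. c i) = z [^] k" .
  have 1: "(\<Otimes>i \<in> {1..Suc k}. c i) = z [^] k \<otimes> a"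
    using z a 0 cc by (simp add: atLeastAtMostSuc_conv m_comm) (simp add: c_def m_comm)
  have 2: "(\<Otimes>i \<in> {1..Suc (Suc k)}. c i) = z [^] k \<otimes> a \<otimes> b"
  proof -
    have "(\<Otimes>i \<in> {1..Suc (Suc k)}. c i) = c (Suc (Suc k)) \<otimes> (\<Otimes>i \<in> {1..Suc k}. c i)"
      using c by (subst atLeastAtMostSuc_conv) auto
    thus ?thesis
      using z a b 1 by (simp add: c_def m_comm)
  qed
  have "(\<Otimes>i \<in> {1..Suc k}. c i) \<in> I \<or> c (Suc (Suc k)) \<in> I"
    using assms(1) c mem 2 unfolding OA_ideal_def by force
  thus ?thesis
    using 1 by (simp add: c_def)
qed

text \<open>
  Suppose \<open>a b \<in> J\<close> with nonunits \<open>a, b \<notin> J\<close>, and let \<open>z\<close> be a nonunit outside \<open>P\<close>. Then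
  \<open>z\<^sup>n\<^sup>-\<^sup>1 a b \<in> J\<close> gives \<open>z\<^sup>n\<^sup>-\<^sup>1 a \<in> J\<close>, and \<open>z\<^sup>n a = z\<^sup>n\<^sup>-\<^sup>1 z a \<in> J\<close> gives \<open>z\<^sup>n \<in> J \<subseteq> P\<close>: a contradiction.
\<close>

lemma (in cring) OA_ideal_below_prime:
  assumes n: "n \<ge> 1" and J: "OA_ideal n J R" and JP: "J \<subseteq> P"
    and P: "primeideal P R" "\<not> maximalideal P R"
  shows "primeideal J R"
proof -
  obtain k where k: "n = Suc k"
    using n by (cases n) auto
  interpret P: primeideal P R by fact
  have JI: "ideal J R" and proper: "J \<noteq> carrier R"
    using J unfolding OA_ideal_def by auto
  interpret J: ideal J R by fact
  obtain z where z: "z \<in> carrier R - Units R" "z \<notin> P"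
    using nonunit_outside_nonmaximal[OF P.is_ideal _ P(2)] P.I_notcarr by blast
  have pow: "z [^] i \<notin> P" for i :: nat
  proof (induct i)
    case 0
    show ?case using P.one_imp_carrier P.I_notcarr by auto
  next
    case (Suc i)
    thus ?case using P.I_prime[of "z [^] i" z] z by auto
  qed
  have unit_cancel: "b \<in> J" if "a \<in> Units R" "b \<in> carrier R" "a \<otimes> b \<in> J" for a b
  proof -
    have "inv a \<otimes> (a \<otimes> b) \<in> J"
      using J.I_l_closed[OF that(3), of "inv a"] that(1) by simp
    moreover have "inv a \<otimes> (a \<otimes> b) = b"
      using that Units_closed[OF that(1)] m_assoc[of "inv a" a b] by simp
    ultimately show ?thesis by simp
  qed
  show ?thesis
  proof (rule primeidealI[OF JI is_cring])
    show "carrier R \<noteq> J" using proper by simp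
    fix a b assume a: "a \<in> carrier R" and b: "b \<in> carrier R" and ab: "a \<otimes> b \<in> J"
    show "a \<in> J \<or> b \<in> J"
    proof (cases "a \<in> Units R \<or> b \<in> Units R")
      case True
      thus ?thesis
        using unit_cancel[of a b] unit_cancel[of b a] a b ab by (auto simp: m_comm)
    next
      case False
      have "a \<in> J" if "b \<notin> J"
      proof -
        have "z [^] k \<otimes> a \<otimes> b \<in> J"
          using J.I_l_closed[OF ab, of "z [^] k"] z a b by (simp add: m_assoc)
        hence "z [^] k \<otimes> a \<in> J"
          using OA_ideal_pow_cases[of k J z a b] J k z a b False that by auto
        hence "z \<otimes> (z [^] k \<otimes> a) \<in> J"
          using z J.I_l_closed[of "z [^] k \<otimes> a" z] by simp
        moreover have "z \<otimes> (z [^] k \<otimes> a) = z [^] k \<otimes> z \<otimes> a"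
          using z a by (simp add: m_comm m_assoc m_lcomm)
        ultimately have "z [^] k \<otimes> z \<in> J \<or> a \<in> J"
          using OA_ideal_pow_cases[of k J z z a] J k z a False by auto
        thus ?thesis
          using pow[of "Suc k"] JP by auto
      qed
      thus ?thesis by blast
    qed
  qed
qed

text \<open>
  The cofactor of the factor inside \<open>P\<close> is the product of the remaining factors; it has to be kept
  because \<open>principalideal_if_divides_principals\<close> needs the whole equation \<open>(x) = P A\<close>.
\<close>

lemma (in cring) prime_contains_factor_of_finprod:
  assumes P: "primeideal P R" and fin: "finite S"
    and J: "\<And>i. i \<in> S \<Longrightarrow> ideal (J i) R"
    and sub: "(\<Otimes>\<^bsub>ideals_set R\<^esub> i \<in> S. J i) \<subseteq> P"
  shows "\<exists>i \<in> S. J i \<subseteq> P \<and>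
    (\<exists>A. ideal A R \<and> (\<Otimes>\<^bsub>ideals_set R\<^esub> i \<in> S. J i) = J i \<cdot> A)"
proof -
  interpret IS: comm_monoid "ideals_set R"
    by (rule ideals_set_is_comm_monoid)
  have carr: "carrier (ideals_set R) = {I. ideal I R}"
    and mult: "I \<otimes>\<^bsub>ideals_set R\<^esub> K = I \<cdot> K"
    and one: "\<one>\<^bsub>ideals_set R\<^esub> = carrier R" for I K
    unfolding ideals_set_def by simp_all
  have split: "(\<Otimes>\<^bsub>ideals_set R\<^esub> i \<in> insert j T. J i) = J j \<cdot> (\<Otimes>\<^bsub>ideals_set R\<^esub> i \<in> T. J i)"
    and closed: "ideal (\<Otimes>\<^bsub>ideals_set R\<^esub> i \<in> T. J i) R"
    if "finite T" "j \<notin> T" "insert j T \<subseteq> S" for j T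
    using that J IS.finprod_insert[of T j J] IS.finprod_closed[of J T]
    by (auto simp: carr mult Pi_iff subset_iff)
  have "\<exists>i \<in> T. J i \<subseteq> P" if "T \<subseteq> S" "(\<Otimes>\<^bsub>ideals_set R\<^esub> i \<in> T. J i) \<subseteq> P" for T
    using finite_subset[OF that(1) fin] that
  proof (induct T rule: finite_induct)
    case empty
    thus ?case
      using primeideal.I_notcarr[OF P] ideal.Icarr[OF primeideal.axioms(1)[OF P]]
      by (auto simp: one)
  next
    case (insert j T)
    thus ?case
      using primeideal_divides_ideal_prod[OF P J[of j] closed[of T j]] split[of T j] by auto
  qed
  then obtain i where i: "i \<in> S" "J i \<subseteq> P"
    using sub by blast
  have "insert i (S - {i}) = S"
    using i(1) by blast
  hence "(\<Otimes>\<^bsub>ideals_set R\<^esub> i \<in> S. J i) = J i \<cdot> (\<Otimes>\<^bsub>ideals_set R\<^esub> i \<in> S - {i}. J i)"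
    and "ideal (\<Otimes>\<^bsub>ideals_set R\<^esub> i \<in> S - {i}. J i) R"
    using split[of "S - {i}" i] closed[of "S - {i}" i] fin by auto
  thus ?thesis
    using i by blast
qed

section \<open>Minimal primes\<close>

theorem lemma2p4:
  fixes R :: "('a, 'b) ring_scheme" and n :: nat
  assumes "n \<ge> 1"
    and "local_ring R"
    and "\<And>I. principalideal I R \<Longrightarrow> I \<noteq> carrier R \<Longrightarrow> has_OA_factorization n I R"
    and "minimal_primeideal P R"
    and "\<not> maximalideal P R"
  shows "principalideal P R"
proof -
  interpret local_ring R by fact
  have P: "primeideal P R" and min: "\<And>Q. primeideal Q R \<Longrightarrow> Q \<subseteq> P \<Longrightarrow> Q = P"
    using assms(4) unfolding minimal_primeideal_def by auto
  interpret P: primeideal P R by fact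
  have "\<exists>A. ideal A R \<and> PIdl\<^bsub>R\<^esub> x = P \<cdot>\<^bsub>R\<^esub> A" if x: "x \<in> P" for x
  proof -
    have sub: "PIdl\<^bsub>R\<^esub> x \<subseteq> P"
      using cgenideal_minimal[OF P.is_ideal x] .
    hence "PIdl\<^bsub>R\<^esub> x \<noteq> carrier R"
      using P.I_notcarr P.a_subset by blast
    then obtain m :: nat and J where J: "\<And>i. i \<in> {1..m} \<Longrightarrow> OA_ideal n (J i) R"
      and eq: "PIdl\<^bsub>R\<^esub> x = (\<Otimes>\<^bsub>ideals_set R\<^esub> i \<in> {1..m}. J i)"
      using assms(3)[OF cgenideal_is_principalideal[OF P.Icarr[OF x]]]
      unfolding has_OA_factorization_def by blast
    obtain i A where i: "i \<in> {1..m}" "J i \<subseteq> P" and A: "ideal A R" "PIdl\<^bsub>R\<^esub> x = J i \<cdot>\<^bsub>R\<^esub> A"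
      using prime_contains_factor_of_finprod[OF P, of "{1..m}" J] J sub eq
      unfolding OA_ideal_def by auto
    have "J i = P"
      using OA_ideal_below_prime[OF assms(1) J[OF i(1)] i(2) P assms(5)] min i(2) by blast
    thus ?thesis
      using A by blast
  qed
  thus ?thesis
    by (rule principalideal_if_divides_principals[OF P.is_ideal])
qed

end
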